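(* Let $k\geq 5$ be an integer and let $A$ be a finite set of $k$ non-negative integers with $0\in A$. Then $$|3\hat{}_{\underline{+}}A| \geq 6k-11.$$ Moreover, if $|3\hat{}_{\underline{+}}A|=6k-11$, then $A=d*[0,k-1]$ for some positive integer $d$.
   Context: For a finite set $A=\{a_0,a_1,\ldots,a_{k-1}\}$ of $k$ distinct integers and an integer $1\leq h\leq k$, the $h$-fold restricted signed sumset of $A$ is $$h\hat{}_{\underline{+}}A:=\Big\{\sum_{i=0}^{k-1}\lambda_i a_i : (\lambda_0,\ldots,\lambda_{k-1})\in\{-1,0,1\}^k,\ \sum_{i=0}^{k-1}|\lambda_i|=h\Big\}.$$ $|S|$ denotes the cardinality of a finite set $S$. For integers $a\leq b$, $[a,b]=\{n\in\mathbb{Z}: a\leq n\leq b\}$. For an integer $d$ and a set $S$ of integers, $d*S=\{d\cdot s : s\in S\}$ is the $d$-dilation of $S$. *)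

theory Defs
  imports Main
begin

(* The coefficients are indexed by the elements of A themselves, which amounts to an
   enumeration a_0, ..., a_{k-1} of A without repetition.  Values of c outside A are
   irrelevant.  Meant for finite A (the sums are 0 by convention otherwise). *)
definition restricted_signed_sumset :: "nat \<Rightarrow> int set \<Rightarrow> int set" where
  "restricted_signed_sumset h A =
     {\<Sum>a\<in>A. c a * a | c :: int \<Rightarrow> int.
        (\<forall>a\<in>A. c a \<in> {-1, 0, 1}) \<and> (\<Sum>a\<in>A. \<bar>c a\<bar>) = int h}"

definition dilation :: "int \<Rightarrow> int set \<Rightarrow> int set" where
  "dilation d S = {d * s | s. s \<in> S}"

end

theory Submission
  imports Defs
begin

text \<open>
  Adjoining to a set \<open>A\<close> of non-negative integers an integer \<open>m\<close> above all its elements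
  creates at least six new signed sums (\<open>card_insert_above_ge\<close>): if
  \<open>m\<^sub>1 > m\<^sub>2 > m\<^sub>3\<close> are the three largest elements of \<open>A\<close>, then no signed sum over \<open>A\<close> exceeds \<open>m\<^sub>1 + m\<^sub>2 + m\<^sub>3\<close>, whereas
  \<open>m + m\<^sub>2 + m\<^sub>3 < m + m\<^sub>1 + m\<^sub>3 < m + m\<^sub>1 + m\<^sub>2\<close> all do, and their negatives are new
  by symmetry. So the bound \<open>6 k - 11\<close> propagates by induction on \<open>k\<close> from \<open>k = 5\<close>.

  Equality propagates as well. If it holds for \<open>k + 1\<close>, it must hold for the set \<open>A\<close> of the
  \<open>k\<close> smaller elements, which is then \<open>d * [0, k - 1]\<close>, and its signed sums are multiples of
  \<open>d\<close> of size at most \<open>d (3 k - 6)\<close>. If \<open>m \<noteq> d k\<close>, then \<open>m + d (k - 2) + d (k - 4)\<close> is a fourth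
  new positive sum (\<open>insert_above_progression\<close>): it is smaller than the three listed above,
  and it is not a signed sum over \<open>A\<close>, being too large when \<open>m > d k\<close> and not a multiple of \<open>d\<close> when
  \<open>d (k - 1) < m < d k\<close>.

  This leaves \<open>A = {0 < a < b < c < e}\<close>, treated in \<open>ten_positive_sums\<close>. There the eight
  sums \<open>e \<plusminus> a, e \<plusminus> b, e \<plusminus> c, e + a + c, e + b + c\<close> are distinct and positive, and
  unless \<open>(a, b, c, e)\<close> is proportional to \<open>(1, 2, 3, 4)\<close> there are ten positive
  sums, hence at least \<open>20 > 19 = 6 \<sdot> 5 - 11\<close> sums in total. The proportional
  sets have 19: \<open>\<plusminus> a, \<dots>, \<plusminus> 9 a\<close> and 0.
\<close>

section \<open>Signed sums of three distinct elements\<close>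

text \<open>Coefficients in \<open>{-1, 0, 1}\<close> whose absolute values add up to 3 are supported on exactly
  three points, so coefficient functions can be traded for three elements and three signs.\<close>

lemma mem_restricted_signed_sumset_3_iff:
  assumes "finite A"
  shows "s \<in> restricted_signed_sumset 3 A \<longleftrightarrow>
    (\<exists>x\<in>A. \<exists>y\<in>A. \<exists>z\<in>A. \<exists>p\<in>{-1,1}. \<exists>q\<in>{-1,1}. \<exists>r\<in>{-1,1}.
      x \<noteq> y \<and> x \<noteq> z \<and> y \<noteq> z \<and> s = p * x + q * y + r * z)" (is "?L \<longleftrightarrow> ?R")
proof
  assume ?L
  then obtain c :: "int \<Rightarrow> int" where s: "s = (\<Sum>a\<in>A. c a * a)"
    and c: "\<forall>a\<in>A. c a \<in> {-1, 0, 1}" and h: "(\<Sum>a\<in>A. \<bar>c a\<bar>) = 3"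
    unfolding restricted_signed_sumset_def by auto
  define U where "U = {a \<in> A. c a \<noteq> 0}"
  have U: "U \<subseteq> A" and unit: "\<And>a. a \<in> U \<Longrightarrow> c a \<in> {-1, 1}"
    using c by (auto simp: U_def)
  have "(\<Sum>a\<in>A. \<bar>c a\<bar>) = (\<Sum>a\<in>U. \<bar>c a\<bar>)"
    by (rule sum.mono_neutral_right) (use assms in \<open>auto simp: U_def\<close>)
  also have "\<dots> = (\<Sum>a\<in>U. 1)"
    by (rule sum.cong) (use unit in force)+
  finally have "card U = 3" using h by simp
  then obtain x y z where xyz: "U = {x, y, z}" "x \<noteq> y" "x \<noteq> z" "y \<noteq> z"
    by (auto simp: card_3_iff)
  have "s = (\<Sum>a\<in>U. c a * a)"
    unfolding s by (rule sum.mono_neutral_right) (use assms in \<open>auto simp: U_def\<close>)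
  then have "s = c x * x + c y * y + c z * z" using xyz by simp
  moreover have "x \<in> A" "y \<in> A" "z \<in> A" using U xyz by auto
  moreover have "c x \<in> {-1, 1}" "c y \<in> {-1, 1}" "c z \<in> {-1, 1}" using unit xyz by auto
  ultimately show ?R using xyz by blast
next
  assume ?R
  then obtain x y z p q r where A: "{x, y, z} \<subseteq> A"
    and pqr: "p \<in> {-1, 1}" "q \<in> {-1, 1}" "r \<in> {-1, 1}"
    and ne: "x \<noteq> y" "x \<noteq> z" "y \<noteq> z" and s: "s = p * x + q * y + r * z"
    by blast
  define c where "c a = (if a = x then p else if a = y then q else if a = z then r else 0)" for a
  have "(\<Sum>a\<in>A. c a * a) = (\<Sum>a\<in>{x, y, z}. c a * a)"
    by (rule sum.mono_neutral_right) (use assms A in \<open>auto simp: c_def\<close>)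
  moreover have "(\<Sum>a\<in>A. \<bar>c a\<bar>) = (\<Sum>a\<in>{x, y, z}. \<bar>c a\<bar>)"
    by (rule sum.mono_neutral_right) (use assms A in \<open>auto simp: c_def\<close>)
  moreover have "c x = p" "c y = q" "c z = r" using ne by (simp_all add: c_def)
  moreover have "\<bar>p\<bar> = 1" "\<bar>q\<bar> = 1" "\<bar>r\<bar> = 1" using pqr by auto
  ultimately have "s = (\<Sum>a\<in>A. c a * a)" "(\<Sum>a\<in>A. \<bar>c a\<bar>) = int 3"
    using ne s by simp_all
  moreover have "\<forall>a\<in>A. c a \<in> {-1, 0, 1}" using pqr by (auto simp: c_def)
  ultimately show ?L unfolding restricted_signed_sumset_def by blast
qed

lemma restricted_signed_sumset_3_intros:
  assumes "finite A" "x \<in> A" "y \<in> A" "z \<in> A" "x \<noteq> y" "x \<noteq> z" "y \<noteq> z"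
  shows "x + y + z \<in> restricted_signed_sumset 3 A"
    and "x + y - z \<in> restricted_signed_sumset 3 A"
    and "x - y - z \<in> restricted_signed_sumset 3 A"
proof -
  have *: "p * x + q * y + r * z \<in> restricted_signed_sumset 3 A"
    if "p \<in> {-1, 1}" "q \<in> {-1, 1}" "r \<in> {-1, 1}" for p q r
    unfolding mem_restricted_signed_sumset_3_iff[OF assms(1)] using assms that by blast
  show "x + y + z \<in> restricted_signed_sumset 3 A"
    "x + y - z \<in> restricted_signed_sumset 3 A"
    "x - y - z \<in> restricted_signed_sumset 3 A"
    using *[of 1 1 1] *[of 1 1 "-1"] *[of 1 "-1" "-1"] by simp_all
qed

lemma restricted_signed_sumset_3_mono:
  assumes "finite B" "A \<subseteq> B"
  shows "restricted_signed_sumset 3 A \<subseteq> restricted_signed_sumset 3 B"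
proof
  fix s
  assume "s \<in> restricted_signed_sumset 3 A"
  then obtain x y z p q r where *: "x \<in> A" "y \<in> A" "z \<in> A" "p \<in> {-1, 1}" "q \<in> {-1, 1}" "r \<in> {-1, 1}"
    "x \<noteq> y \<and> x \<noteq> z \<and> y \<noteq> z \<and> s = p * x + q * y + r * z"
    unfolding mem_restricted_signed_sumset_3_iff[OF finite_subset[OF assms(2,1)]] by blast
  moreover have "x \<in> B" "y \<in> B" "z \<in> B" using * assms(2) by auto
  ultimately show "s \<in> restricted_signed_sumset 3 B"
    unfolding mem_restricted_signed_sumset_3_iff[OF assms(1)] by blast
qed

lemma uminus_restricted_signed_sumset_3:
  assumes "finite A" "s \<in> restricted_signed_sumset 3 A"
  shows "- s \<in> restricted_signed_sumset 3 A"
proof -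
  obtain x y z p q r where *: "x \<in> A" "y \<in> A" "z \<in> A" "p \<in> {-1, 1}" "q \<in> {-1, 1}" "r \<in> {-1, 1}"
    "x \<noteq> y" "x \<noteq> z" "y \<noteq> z" "s = p * x + q * y + r * z"
    using assms unfolding mem_restricted_signed_sumset_3_iff[OF assms(1)] by blast
  have "- s = (- p) * x + (- q) * y + (- r) * z" "- p \<in> {-1, 1}" "- q \<in> {-1, 1}" "- r \<in> {-1, 1}"
    using * by auto
  then show ?thesis
    unfolding mem_restricted_signed_sumset_3_iff[OF assms(1)] using *(1-3,7-9) by blast
qed

lemma finite_restricted_signed_sumset_3:
  assumes "finite A"
  shows "finite (restricted_signed_sumset 3 A)"
proof (rule finite_subset)
  let ?C = "A \<union> uminus ` A"
  show "restricted_signed_sumset 3 A \<subseteq> (\<lambda>(u, v, w). u + v + w) ` (?C \<times> ?C \<times> ?C)"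
  proof
    fix s
    assume "s \<in> restricted_signed_sumset 3 A"
    then obtain x y z p q r where *: "x \<in> A" "y \<in> A" "z \<in> A"
      "p \<in> {-1, 1}" "q \<in> {-1, 1}" "r \<in> {-1, 1}" "s = p * x + q * y + r * z"
      unfolding mem_restricted_signed_sumset_3_iff[OF assms] by blast
    have "p * x \<in> ?C" "q * y \<in> ?C" "r * z \<in> ?C" using * by auto
    then show "s \<in> (\<lambda>(u, v, w). u + v + w) ` (?C \<times> ?C \<times> ?C)"
      using *(7) by (intro image_eqI[of _ _ "(p * x, q * y, r * z)"]) simp_all
  qed
qed (use assms in auto)

text \<open>The sumset is symmetric about 0, so only positive sums need to be exhibited: each new one
  comes with its negative. The part \<^term>\<open>T\<close> already counted will be the sumset of a
  smaller set, \<open>{0}\<close> or \<open>{}\<close>.\<close>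

lemma card_restricted_signed_sumset_3_ge:
  assumes "finite A"
    and T: "T \<subseteq> restricted_signed_sumset 3 A" "\<And>t. t \<in> T \<Longrightarrow> - t \<in> T"
    and X: "X \<subseteq> restricted_signed_sumset 3 A" "\<And>x. x \<in> X \<Longrightarrow> x > 0" "X \<inter> T = {}"
  shows "card T + 2 * card X \<le> card (restricted_signed_sumset 3 A)"
proof -
  let ?S = "restricted_signed_sumset 3 A"
  have S: "finite ?S" by (rule finite_restricted_signed_sumset_3) fact
  have fin: "finite T" "finite X" using S T X finite_subset by blast+
  have "- x \<notin> X" if "x \<in> X" for x using X(2)[OF that] X(2)[of "- x"] by auto
  then have 1: "X \<inter> uminus ` X = {}" by auto
  have "- x \<notin> T" if "x \<in> X" for x using T(2)[of "- x"] X(3) that by auto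
  then have 2: "T \<inter> (X \<union> uminus ` X) = {}" using X(3) by auto
  have "card (X \<union> uminus ` X) = 2 * card X"
    using fin 1 by (simp add: card_Un_disjoint card_image)
  then have "card T + 2 * card X = card (T \<union> (X \<union> uminus ` X))"
    using fin 2 by (simp add: card_Un_disjoint)
  also have "\<dots> \<le> card ?S"
    using S T X uminus_restricted_signed_sumset_3[OF assms(1)] by (intro card_mono) auto
  finally show ?thesis .
qed

section \<open>Sets with five elements\<close>

text \<open>If \<open>b \<noteq> 2 a\<close>, the sums \<open>e \<plusminus> (b - a)\<close> are new with respect to the basic eight. If
  \<open>b = 2 a\<close> but \<open>c \<noteq> 3 a\<close>, the sums \<open>e + a + b\<close> and \<open>e - (c - a)\<close> are. Finally, for
  \<open>{0, a, 2 a, 3 a, e}\<close> the multiples \<open>a, \<dots>, 6 a\<close> and \<open>e + a, \<dots>, e + 5 a\<close> are sums; as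
  \<open>e > 3 a\<close> and \<open>e \<noteq> 4 a\<close>, two of them can coincide only when \<open>e = 5 a\<close>, and in that
  case they are \<open>a, \<dots>, 10 a\<close>.\<close>

lemma ten_positive_sums:
  fixes a b c e :: int
  assumes ord: "0 < a" "a < b" "b < c" "c < e"
    and A: "A = {0, a, b, c, e}"
    and ne: "\<not> (b = 2 * a \<and> c = 3 * a \<and> e = 4 * a)"
  obtains X where "X \<subseteq> restricted_signed_sumset 3 A" "\<And>x. x \<in> X \<Longrightarrow> x > 0" "card X = 10"
proof -
  have fin: "finite A" using A by simp
  note S = restricted_signed_sumset_3_intros[OF fin]
  have eq: "card (set xs) = 10" if "distinct xs" "length xs = 10" for xs :: "int list"
    using distinct_card[OF that(1)] that(2) by simp
  consider "b \<noteq> 2 * a" | "b = 2 * a" "c \<noteq> 3 * a"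
    | "b = 2 * a" "c = 3 * a" "e = 5 * a"
    | "b = 2 * a" "c = 3 * a" "e \<noteq> 4 * a" "e \<noteq> 5 * a"
    using ne by blast
  then show ?thesis
  proof cases
    case 1
    let ?xs = "[e+b+c, e+a+c, e+c, e+b, e+a, e-a, e-b, e-c, e+b-a, e+a-b]"
    show ?thesis
    proof (rule that[of "set ?xs"])
      show "card (set ?xs) = 10"
        by (rule eq) (use ord 1 in auto)
      show "set ?xs \<subseteq> restricted_signed_sumset 3 A"
        using ord S[of e b c] S[of e a c] S[of e c 0] S[of e b 0] S[of e a 0]
          S[of e 0 a] S[of e 0 b] S[of e 0 c] S[of e b a] S[of e a b]
        by (simp add: A)
    qed (use ord in auto)
  next
    case 2
    let ?xs = "[e+b+c, e+a+c, e+c, e+b, e+a, e-a, e-b, e-c, e+a+b, e+a-c]"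
    show ?thesis
    proof (rule that[of "set ?xs"])
      show "card (set ?xs) = 10"
        by (rule eq) (use ord 2 in auto)
      show "set ?xs \<subseteq> restricted_signed_sumset 3 A"
        using ord S[of e b c] S[of e a c] S[of e c 0] S[of e b 0] S[of e a 0]
          S[of e 0 a] S[of e 0 b] S[of e 0 c] S[of e a b] S[of e a c]
        by (simp add: A)
    qed (use ord in auto)
  next
    case 3
    let ?xs = "[a, 2*a, 3*a, 4*a, 5*a, 6*a, 7*a, 8*a, 9*a, 10*a]"
    show ?thesis
    proof (rule that[of "set ?xs"])
      show "card (set ?xs) = 10"
        by (rule eq) (use ord 3 in auto)
      show "set ?xs \<subseteq> restricted_signed_sumset 3 A"
        using ord S[of a 0 b] S[of b a 0] S[of c b 0] S[of c a 0] S[of c b a] S[of e b 0]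
          S[of e c 0] S[of e a b] S[of e a c] S[of e b c] S[of e 0 a] S[of e a 0] S[of b 0 a]
        by (simp add: A 3)
    qed (use ord in auto)
  next
    case 4
    let ?xs = "[a, 2*a, 3*a, 4*a, 5*a, e+a, e+2*a, e+3*a, e+4*a, e+5*a]"
    show ?thesis
    proof (rule that[of "set ?xs"])
      show "card (set ?xs) = 10"
        by (rule eq) (use ord 4 in auto)
      show "set ?xs \<subseteq> restricted_signed_sumset 3 A"
        using ord S[of b 0 a] S[of c 0 a] S[of b a 0] S[of c a 0] S[of c b 0]
          S[of e a 0] S[of e b 0] S[of e c 0] S[of e a c] S[of e b c]
        by (simp add: A 4 ac_simps)
    qed (use ord in auto)
  qed
qed

text \<open>Here only nine positive sums are available, \<open>a, \<dots>, 9 a\<close>, and the bound is reached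
  because \<open>0 = a + 2 a - 3 a\<close> is a sum too.\<close>

lemma card_ge_19_of_progression:
  fixes a :: int
  assumes a: "0 < a" and A: "A = {0, a, 2 * a, 3 * a, 4 * a}"
  shows "19 \<le> card (restricted_signed_sumset 3 A)"
proof -
  have fin: "finite A" using A by simp
  note S = restricted_signed_sumset_3_intros[OF fin]
  let ?xs = "[a, 2*a, 3*a, 4*a, 5*a, 6*a, 7*a, 8*a, 9*a]"
  have "distinct ?xs" using a by simp
  then have "card (set ?xs) = length ?xs" by (rule distinct_card)
  moreover have "card {0::int} + 2 * card (set ?xs) \<le> card (restricted_signed_sumset 3 A)"
  proof (rule card_restricted_signed_sumset_3_ge[OF fin])
    show "set ?xs \<subseteq> restricted_signed_sumset 3 A"
      using a S[of "2*a" 0 a] S[of "3*a" 0 a] S[of "2*a" a 0] S[of "3*a" a 0] S[of "3*a" "2*a" 0]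
        S[of "4*a" "2*a" 0] S[of "4*a" "3*a" 0] S[of "4*a" "3*a" a] S[of "4*a" "3*a" "2*a"]
      by (simp add: A)
    show "{0} \<subseteq> restricted_signed_sumset 3 A"
      using a S(2)[of a "2*a" "3*a"] by (simp add: A)
  qed (use a in auto)
  ultimately show ?thesis by simp
qed

lemma five_element_case:
  fixes A :: "int set"
  assumes fin: "finite A" and card: "card A = 5" and nonneg: "\<forall>x\<in>A. x \<ge> 0" and zero: "0 \<in> A"
  shows "19 \<le> card (restricted_signed_sumset 3 A) \<and>
    (card (restricted_signed_sumset 3 A) = 19 \<longrightarrow> (\<exists>d>0. A = dilation d {0..4}))"
proof -
  obtain xs where xs: "set xs = A" "sorted_wrt (<) xs" "length xs = 5"
    using that[of "sorted_list_of_set A"] fin card by simp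
  then obtain o' a b c e where "xs = [o', a, b, c, e]"
    by (auto simp: eval_nat_numeral length_Suc_conv)
  then have A: "A = {o', a, b, c, e}" and ord: "o' < a" "a < b" "b < c" "c < e"
    using xs by auto
  have "0 \<le> o'" using nonneg A by simp
  then have "o' = 0" using zero ord unfolding A by auto
  with A ord have A: "A = {0, a, b, c, e}" and a: "0 < a" by auto
  show ?thesis
  proof (cases "b = 2 * a \<and> c = 3 * a \<and> e = 4 * a")
    case True
    have "{0..4} = {0, 1, 2, 3, 4::int}" by auto
    with True have "A = dilation a {0..4}"
      unfolding A dilation_def by (auto simp: mult.commute)
    moreover have "19 \<le> card (restricted_signed_sumset 3 A)"
      using card_ge_19_of_progression[OF a] A True by auto
    ultimately show ?thesis using a by blast
  next
    case False
    obtain X where X: "X \<subseteq> restricted_signed_sumset 3 A" "\<And>x. x \<in> X \<Longrightarrow> x > 0" "card X = 10"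
      using ten_positive_sums[OF a ord(2-4) A False] by blast
    have "20 \<le> card (restricted_signed_sumset 3 A)"
      using card_restricted_signed_sumset_3_ge[OF fin, of "{}" X] X by simp
    then show ?thesis by simp
  qed
qed

section \<open>Adjoining a new largest element\<close>

lemma obtain_three_largest:
  fixes A :: "'a :: linorder set"
  assumes "finite A" "card A \<ge> 3"
  obtains x y z where "x \<in> A" "y \<in> A" "z \<in> A" "z < y" "y < x"
    "\<And>t. t \<in> A \<Longrightarrow> t = x \<or> t = y \<or> t \<le> z"
proof -
  define x where "x = Max A"
  define B where "B = A - {x}"
  define y where "y = Max B"
  define C where "C = B - {y}"
  define z where "z = Max C"
  have x: "x \<in> A" "\<And>t. t \<in> A \<Longrightarrow> t \<le> x"
    using assms unfolding x_def by (auto intro!: Max_in)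
  have B: "finite B" "card B \<ge> 2" using assms x unfolding B_def by auto
  have y: "y \<in> B" "\<And>t. t \<in> B \<Longrightarrow> t \<le> y"
    using B unfolding y_def by (auto intro!: Max_in)
  have C: "finite C" "card C \<ge> 1" using B y unfolding C_def by auto
  have z: "z \<in> C" "\<And>t. t \<in> C \<Longrightarrow> t \<le> z"
    using C unfolding z_def by (auto intro!: Max_in)
  show ?thesis
  proof (rule that[of x y z])
    show "y < x" using x y(1) unfolding B_def by (auto simp: order.strict_iff_order)
    show "z < y" using y z(1) unfolding C_def by (auto simp: order.strict_iff_order)
    show "t = x \<or> t = y \<or> t \<le> z" if "t \<in> A" for t
      using z(2) that unfolding B_def C_def by blast
  qed (use x y z in \<open>auto simp: B_def C_def\<close>)
qed

lemma restricted_signed_sumset_3_le: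
  fixes A :: "int set"
  assumes "finite A" "\<forall>t\<in>A. t \<ge> 0"
    and xyz: "z < y" "y < x" "\<And>t. t \<in> A \<Longrightarrow> t = x \<or> t = y \<or> t \<le> z"
    and s: "s \<in> restricted_signed_sumset 3 A"
  shows "s \<le> x + y + z"
proof -
  obtain u v w p q r where *: "u \<in> A" "v \<in> A" "w \<in> A" "p \<in> {-1, 1}" "q \<in> {-1, 1}" "r \<in> {-1, 1}"
    "u \<noteq> v" "u \<noteq> w" "v \<noteq> w" "s = p * u + q * v + r * w"
    using s unfolding mem_restricted_signed_sumset_3_iff[OF assms(1)] by blast
  have "e * t \<le> t" if "e \<in> {-1, 1}" "t \<in> A" for e t using that assms(2) by auto
  then have "p * u \<le> u" "q * v \<le> v" "r * w \<le> w" using *(1-6) by blast+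
  then have "s \<le> u + v + w" using *(10) by linarith
  also have "\<dots> \<le> x + y + z"
    using xyz(3)[OF *(1)] xyz(3)[OF *(2)] xyz(3)[OF *(3)] *(7-9) xyz(1,2) by (smt (verit))
  finally show ?thesis .
qed

text \<open>The set \<^term>\<open>Y\<close> collects additional new sums below the three obvious ones; it is
  empty for the inequality and a singleton for the equality case.\<close>

lemma card_insert_above_ge:
  fixes A :: "int set"
  assumes fin: "finite A" and nonneg: "\<forall>t\<in>A. t \<ge> 0"
    and m: "\<And>t. t \<in> A \<Longrightarrow> t < m"
    and xyz: "x \<in> A" "y \<in> A" "z \<in> A" "z < y" "y < x"
      "\<And>t. t \<in> A \<Longrightarrow> t = x \<or> t = y \<or> t \<le> z"
    and Y: "Y \<subseteq> restricted_signed_sumset 3 (insert m A)"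
      "Y \<inter> restricted_signed_sumset 3 A = {}" "\<And>t. t \<in> Y \<Longrightarrow> 0 < t \<and> t < m + y + z"
  shows "card (restricted_signed_sumset 3 A) + 2 * (card Y + 3)
    \<le> card (restricted_signed_sumset 3 (insert m A))"
proof -
  let ?N = "{m + x + y, m + x + z, m + y + z}"
  have fin': "finite (insert m A)" using fin by simp
  have pos: "0 \<le> z" "x < m" using nonneg m xyz by auto
  have finY: "finite Y"
    using Y(1) finite_restricted_signed_sumset_3[OF fin'] finite_subset by blast
  have "Y \<inter> ?N = {}" using Y(3) xyz(4,5) by fastforce
  moreover have "card ?N = 3" using xyz by simp
  moreover have "card (Y \<union> ?N) = card Y + card ?N"
    by (rule card_Un_disjoint) (use finY calculation(1) in auto)
  ultimately have card: "card (Y \<union> ?N) = card Y + 3" by linarith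
  have "card (restricted_signed_sumset 3 A) + 2 * card (Y \<union> ?N)
    \<le> card (restricted_signed_sumset 3 (insert m A))"
  proof (rule card_restricted_signed_sumset_3_ge[OF fin'])
    show "restricted_signed_sumset 3 A \<subseteq> restricted_signed_sumset 3 (insert m A)"
      by (rule restricted_signed_sumset_3_mono[OF fin']) auto
    show "- t \<in> restricted_signed_sumset 3 A" if "t \<in> restricted_signed_sumset 3 A" for t
      using uminus_restricted_signed_sumset_3[OF fin that] .
    show "Y \<union> ?N \<subseteq> restricted_signed_sumset 3 (insert m A)"
      using Y(1) restricted_signed_sumset_3_intros(1)[OF fin', of m] xyz pos by auto
    show "t > 0" if "t \<in> Y \<union> ?N" for t
      using that Y(3) pos xyz(4,5) by auto
    have "s \<le> x + y + z" if "s \<in> restricted_signed_sumset 3 A" for s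
      using restricted_signed_sumset_3_le[OF fin nonneg xyz(4-6) that] .
    then have "?N \<inter> restricted_signed_sumset 3 A = {}"
      using pos xyz(4,5) by fastforce
    then show "(Y \<union> ?N) \<inter> restricted_signed_sumset 3 A = {}"
      using Y(2) by blast
  qed
  then show ?thesis using card by simp
qed

text \<open>Eight new sums are two more than the bound allows in the case of equality, so the only
  extension of a progression that can be extremal is the one by its next term. The three largest
  elements of \<^term>\<open>A\<close> are the multiples \<open>d (k - 1)\<close>, \<open>d (k - 2)\<close>, \<open>d (k - 3)\<close>, and the
  fourth positive new sum replaces \<open>d (k - 3)\<close> by \<open>d (k - 4)\<close> in the smallest of the three
  obvious ones.\<close>

lemma insert_above_progression:
  fixes d m :: int and k :: nat
  assumes k: "k \<ge> 5" and d: "d > 0" and m: "m > d * (int k - 1)" and ne: "m \<noteq> d * int k"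
    and A: "A = dilation d {0..int k - 1}"
  shows "card (restricted_signed_sumset 3 A) + 8 \<le> card (restricted_signed_sumset 3 (insert m A))"
proof -
  have A_iff: "t \<in> A \<longleftrightarrow> (\<exists>j. 0 \<le> j \<and> j \<le> int k - 1 \<and> t = d * j)" for t
    unfolding A dilation_def by auto
  have fin: "finite A" unfolding A dilation_def by simp
  have nonneg: "\<forall>t\<in>A. t \<ge> 0" using d by (auto simp: A_iff)
  have below: "t < m" if t: "t \<in> A" for t
  proof -
    obtain j where "j \<le> int k - 1" "t = d * j" using t by (auto simp: A_iff)
    then have "t \<le> d * (int k - 1)" using mult_left_mono[of j "int k - 1" d] d by linarith
    then show ?thesis using m by simp
  qed
  have mem: "d * (int k - i) \<in> A" if "1 \<le> i" "i \<le> 4" for i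
    using that k unfolding A_iff by (intro exI[of _ "int k - i"]) auto
  have top: "t = d * (int k - 1) \<or> t = d * (int k - 2) \<or> t \<le> d * (int k - 3)"
    if t: "t \<in> A" for t
  proof -
    obtain j where j: "j \<le> int k - 1" "t = d * j" using t by (auto simp: A_iff)
    then consider "j = int k - 1" | "j = int k - 2" | "j \<le> int k - 3" by linarith
    then show ?thesis
    proof cases
      case 3
      then have "d * j \<le> d * (int k - 3)" using d by (intro mult_left_mono) auto
      then show ?thesis using j by blast
    qed (use j in blast)+
  qed
  have fin': "finite (insert m A)" using fin by simp
  let ?w = "m + d * (int k - 2) + d * (int k - 4)"
  have "card (restricted_signed_sumset 3 A) + 2 * (card {?w} + 3)
    \<le> card (restricted_signed_sumset 3 (insert m A))"
  proof (rule card_insert_above_ge[OF fin nonneg below])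
    show "d * (int k - 1) \<in> A" "d * (int k - 2) \<in> A" "d * (int k - 3) \<in> A"
      using mem by auto
    show "d * (int k - 3) < d * (int k - 2)" "d * (int k - 2) < d * (int k - 1)"
      using d by auto
    show "t = d * (int k - 1) \<or> t = d * (int k - 2) \<or> t \<le> d * (int k - 3)" if "t \<in> A" for t
      using top[OF that] .
    show "{?w} \<subseteq> restricted_signed_sumset 3 (insert m A)"
      using restricted_signed_sumset_3_intros(1)[OF fin', of m "d * (int k - 2)" "d * (int k - 4)"]
        mem[of 2] mem[of 4] below[of "d * (int k - 2)"] below[of "d * (int k - 4)"] d by auto
    have "d * (int k - 2) \<ge> 0" "d * (int k - 4) \<ge> 0" "m > 0"
      using mem[of 2] mem[of 4] nonneg below[of "d * (int k - 4)"] by force+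
    moreover have "d * (int k - 4) < d * (int k - 3)" using d by simp
    ultimately show "0 < t \<and> t < m + d * (int k - 2) + d * (int k - 3)" if "t \<in> {?w}" for t
      using that by auto
    have "?w \<notin> restricted_signed_sumset 3 A"
    proof
      assume w: "?w \<in> restricted_signed_sumset 3 A"
      have "?w \<le> d * (int k - 1) + d * (int k - 2) + d * (int k - 3)"
        by (rule restricted_signed_sumset_3_le[OF fin nonneg _ _ top w]) (use d in auto)
      \<comment> \<open>Size and divisibility leave only the excluded multiple of \<open>d\<close> for \<open>m\<close>.\<close>
      then have "m \<le> d * int k" by (simp add: algebra_simps)
      moreover have "d dvd m"
      proof -
        have "d dvd t" if "t \<in> A" for t using that by (auto simp: A_iff)
        then have "d dvd ?w"
          using w unfolding mem_restricted_signed_sumset_3_iff[OF fin] by fastforce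
        then show ?thesis by (simp add: dvd_add_left_iff)
      qed
      then obtain j where j: "m = d * j" by auto
      ultimately have "j \<le> int k" "j > int k - 1" using d m by auto
      then show False using ne j by simp
    qed
    then show "{?w} \<inter> restricted_signed_sumset 3 A = {}" by blast
  qed
  then show ?thesis by simp
qed

section \<open>The bound and its extremal sets\<close>

theorem theorem3p4:
  fixes k :: nat and A :: "int set"
  assumes "k \<ge> 5"
    and "finite A" and "card A = k"
    and "\<forall>a\<in>A. a \<ge> 0" and "0 \<in> A"
  shows "int (card (restricted_signed_sumset 3 A)) \<ge> 6 * int k - 11 \<and>
    (int (card (restricted_signed_sumset 3 A)) = 6 * int k - 11 \<longrightarrow>
      (\<exists>d::int. d > 0 \<and> A = dilation d {0..int k - 1}))"
  using assms
proof (induction k arbitrary: A rule: nat_induct_at_least)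
  case base
  then show ?case using five_element_case[of A] by auto
next
  case (Suc k)
  define m where "m = Max A"
  define B where "B = A - {m}"
  have m: "m \<in> A" "\<And>t. t \<in> A \<Longrightarrow> t \<le> m"
    using Suc.prems unfolding m_def by (auto intro!: Max_in)
  have A: "A = insert m B" using m B_def by auto
  have B: "finite B" "card B = k" "\<forall>t\<in>B. t \<ge> 0"
    using Suc.prems m unfolding B_def by auto
  have below: "t < m" if "t \<in> B" for t
    using that m(2)[of t] unfolding B_def by auto
  have zero: "0 \<in> B"
  proof -
    obtain t where "t \<in> B" using B(2) Suc.hyps by fastforce
    then have "m \<noteq> 0" using below B(3) by force
    then show ?thesis using Suc.prems unfolding B_def by simp
  qed
  note IH = Suc.IH[OF B zero]
  obtain x y z where xyz: "x \<in> B" "y \<in> B" "z \<in> B" "z < y" "y < x"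
    "\<And>t. t \<in> B \<Longrightarrow> t = x \<or> t = y \<or> t \<le> z"
    using obtain_three_largest[of B] B Suc.hyps by auto
  have "card (restricted_signed_sumset 3 B) + 2 * (card ({} :: int set) + 3)
    \<le> card (restricted_signed_sumset 3 (insert m B))"
    by (rule card_insert_above_ge[OF B(1,3) below xyz]) auto
  then have step: "card (restricted_signed_sumset 3 B) + 6 \<le> card (restricted_signed_sumset 3 A)"
    using A by simp
  show ?case
  proof (intro conjI impI)
    show "6 * int (Suc k) - 11 \<le> int (card (restricted_signed_sumset 3 A))"
      using conjunct1[OF IH] step by simp
    assume eq: "int (card (restricted_signed_sumset 3 A)) = 6 * int (Suc k) - 11"
    then have "int (card (restricted_signed_sumset 3 B)) = 6 * int k - 11"
      using conjunct1[OF IH] step by simp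
    then obtain d where d: "d > 0" "B = dilation d {0..int k - 1}" using IH by blast
    have "d * (int k - 1) \<in> B" using d Suc.hyps unfolding dilation_def by auto
    then have "d * (int k - 1) < m" by (rule below)
    then have "m = d * int k"
      using insert_above_progression[OF Suc.hyps d(1) _ _ d(2), of m] eq IH A by force
    moreover have "{0..int (Suc k) - 1} = insert (int k) {0..int k - 1}" by auto
    ultimately have "A = dilation d {0..int (Suc k) - 1}"
      unfolding A d(2) dilation_def by auto
    then show "\<exists>d::int. d > 0 \<and> A = dilation d {0..int (Suc k) - 1}" using d(1) by blast
  qed
qed

end
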